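(* Let $f:\mathbb{R}\to\mathbb{R}$ be a smooth convex function with a unique extreme point (minimizer) $t^*$, and suppose $f$ satisfies Lipschitz continuous gradient, i.e. there is $\mu>0$ with $|f^{(1)}(x)-f^{(1)}(y)|\le \mu|x-y|$ for all $x,y\in\mathbb{R}$. Let $1<\alpha<2$. Then, for arbitrary step size $\rho>0$, the fractional order gradient method $$t_{k+2}=t_{k+1}-\rho f^{(1)}(t_{k+1})\,|t_{k+1}-t_k|^{1-\alpha},\qquad k\ge 1,$$ always converges to a bounded region of $t^*$: there exists a constant $B\ge 0$ (independent of the initial points) such that every sequence $(t_k)_{k\ge1}$ generated by the method satisfies $\limsup_{k\to\infty}|t_k-t^*|\le B$.
   Context: $f^{(1)}$ denotes the first derivative of $f$. A sequence generated by the method is an infinite real sequence $(t_k)_{k\ge 1}$, started from real initial points $t_1\neq t_2$, satisfying the recursion for all $k\ge1$. Since $1-\alpha<0$, the recursion only makes sense while $t_{k+1}\ne t_k$; it is assumed that $t_{k+1}\neq t_k$ for all $k$. *)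

theory Defs
  imports "HOL-Analysis.Analysis"
begin

text \<open>Sequences are indexed from 1; the value \<open>t 0\<close> is irrelevant. The base of \<open>powr\<close> is positive
  because consecutive iterates are required to be distinct, so the totalisation
  \<open>0 powr a = 0\<close> never matters. The case \<open>k = 1\<close> of that requirement is \<open>t 2 \<noteq> t 1\<close>.\<close>

definition fractional_gradient_seq :: "(real \<Rightarrow> real) \<Rightarrow> real \<Rightarrow> real \<Rightarrow> (nat \<Rightarrow> real) \<Rightarrow> bool" where
  "fractional_gradient_seq f \<alpha> \<rho> t \<longleftrightarrow>
     (\<forall>k\<ge>1. t (k + 1) \<noteq> t k) \<and>
     (\<forall>k\<ge>1. t (k + 2) = t (k + 1) - \<rho> * deriv f (t (k + 1)) * \<bar>t (k + 1) - t k\<bar> powr (1 - \<alpha>))"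

end

theory Submission
  imports Defs
begin

text \<open>Put \<open>u\<^sub>k = t\<^sub>k\<^sub>+\<^sub>1 - t\<^sup>*\<close>, \<open>d\<^sub>k = \<bar>u\<^sub>k\<^sub>+\<^sub>1 - u\<^sub>k\<bar>\<close> and \<open>\<beta> = \<alpha> - 1 \<in> (0,1)\<close>, so that
  \<open>d\<^sub>k\<^sub>+\<^sub>1 = \<rho> \<bar>f'(t\<^sub>k\<^sub>+\<^sub>2)\<bar> d\<^sub>k\<^sup>-\<^sup>\<beta>\<close>. If a step jumps over the minimizer, the new distance to it
  is at most the step length, and the Lipschitz bound gives \<open>d\<^sub>k\<^sub>+\<^sub>1 \<le> \<rho>\<mu> d\<^sub>k\<^sup>1\<^sup>-\<^sup>\<beta>\<close>. Otherwise the
  gradient has not grown, and dividing two consecutive recursions gives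
  \<open>d\<^sub>k\<^sub>+\<^sub>2 \<le> d\<^sub>k\<^sub>+\<^sub>1\<^sup>1\<^sup>-\<^sup>\<beta> d\<^sub>k\<^sup>\<beta>\<close>. On the logarithmic scale, every upper bound \<open>Y\<close> of the step
  lengths improves after the next crossing to \<open>(1 - \<beta> + \<beta>\<^sup>2) Y + const\<close>, so with infinitely many
  crossings the step lengths are eventually below a universal constant, and so are the distances
  to the minimizer. With finitely many crossings the distances decrease, hence the steps tend to
  zero, which forces the gradient and then the distance to tend to zero.\<close>

section \<open>Recursive inequalities for logarithmic step lengths\<close>

lemma crossing_recursion_bounded:
  fixes x :: "nat \<Rightarrow> real" and C :: "nat \<Rightarrow> bool"
  assumes \<beta>: "0 < \<beta>" "\<beta> < 1"
    and cross: "\<And>k. C k \<Longrightarrow> x (Suc k) \<le> c + (1 - \<beta>) * x k"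
    and no_cross: "\<And>k. \<not> C (Suc k) \<Longrightarrow> x (Suc (Suc k)) \<le> (1 - \<beta>) * x (Suc k) + \<beta> * x k"
  shows "\<exists>M. \<forall>k. x k \<le> M"
proof -
  \<comment> \<open>\<open>c / \<beta>\<close> is the fixed point of
    \<open>y \<mapsto> c + (1 - \<beta>) * y\<close>, so any bound above it survives a crossing; the
    other case is a convex combination of two earlier terms.\<close>
  define M where "M = max (max (x 0) (x 1)) (c / \<beta>)"
  have c: "c \<le> \<beta> * M"
  proof -
    have "c / \<beta> \<le> M" by (simp add: M_def)
    then show ?thesis using \<beta> by (simp add: field_simps)
  qed
  have "x k \<le> M \<and> x (Suc k) \<le> M" for k
  proof (induction k)
    case 0
    show ?case unfolding M_def One_nat_def by linarith
  next
    case (Suc k)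
    have 1: "(1 - \<beta>) * x (Suc k) \<le> (1 - \<beta>) * M" using Suc \<beta> by (intro mult_left_mono) auto
    have 2: "\<beta> * x k \<le> \<beta> * M" using Suc \<beta> by (intro mult_left_mono) auto
    have "x (Suc (Suc k)) \<le> \<beta> * M + (1 - \<beta>) * M"
      using cross[of "Suc k"] no_cross[of k] 1 2 c by linarith
    also have "\<dots> = M" by (simp add: algebra_simps)
    finally show ?case using Suc by simp
  qed
  then show ?thesis by blast
qed

text \<open>Just after a crossing one term is at most \<open>c + (1 - \<beta>) * Y\<close>;
  averaging it with a term at most \<open>Y\<close> gives the factor \<open>(1 - \<beta>)\<^sup>2 +
  \<beta> = 1 - \<beta> + \<beta>\<^sup>2\<close>. From then on, averages of improved terms stay
  improved.\<close>

lemma crossing_recursion_contract: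
  fixes x :: "nat \<Rightarrow> real" and C :: "nat \<Rightarrow> bool"
  assumes \<beta>: "0 < \<beta>" "\<beta> < 1" and c: "0 \<le> c" and Y: "0 \<le> Y"
    and cross: "\<And>k. C k \<Longrightarrow> x (Suc k) \<le> c + (1 - \<beta>) * x k"
    and no_cross: "\<And>k. \<not> C (Suc k) \<Longrightarrow> x (Suc (Suc k)) \<le> (1 - \<beta>) * x (Suc k) + \<beta> * x k"
    and inf: "\<exists>\<^sub>\<infinity>k. C k"
    and bound: "\<forall>\<^sub>F k in sequentially. x k \<le> Y"
  shows "\<forall>\<^sub>F k in sequentially. x k \<le> (1 - \<beta> + \<beta>\<^sup>2) * Y + c"
proof -
  define P where "P = (1 - \<beta> + \<beta>\<^sup>2) * Y + c"
  obtain N where N: "\<And>k. k \<ge> N \<Longrightarrow> x k \<le> Y"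
    using bound by (auto simp: eventually_sequentially)
  obtain m where m: "m \<ge> N" "C m"
    using inf by (auto simp: INFM_nat_le)
  have Ck: "x (Suc k) \<le> c + (1 - \<beta>) * Y" if "C k" "k \<ge> N" for k
  proof -
    have "(1 - \<beta>) * x k \<le> (1 - \<beta>) * Y" using N[OF that(2)] \<beta> by (intro mult_left_mono) auto
    then show ?thesis using cross[OF that(1)] by linarith
  qed
  have le_P: "c + (1 - \<beta>) * Y \<le> P"
    using Y by (simp add: P_def algebra_simps)
  \<comment> \<open>The disjunction is needed because at a crossing index \<open>x k\<close> itself
    is only known to be at most \<open>Y\<close>.\<close>
  have "x (Suc k) \<le> P \<and> (C k \<or> x k \<le> P)" if "k \<ge> m" for k
    using that
  proof (induction k rule: dec_induct)
    case base
    then show ?case using Ck m le_P by force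
  next
    case (step k)
    have kN: "k \<ge> N" using step m by simp
    show ?case
    proof (cases "C (Suc k)")
      case True
      then show ?thesis using Ck[of "Suc k"] kN le_P by force
    next
      case False
      note nc = no_cross[OF False]
      have "x (Suc (Suc k)) \<le> P"
      proof (cases "C k")
        case True
        have "(1 - \<beta>) * x (Suc k) \<le> (1 - \<beta>) * (c + (1 - \<beta>) * Y)"
          using Ck[OF True kN] \<beta> by (intro mult_left_mono) auto
        moreover have "\<beta> * x k \<le> \<beta> * Y" using N[OF kN] \<beta> by (intro mult_left_mono) auto
        ultimately have "x (Suc (Suc k)) \<le> (1 - \<beta>) * (c + (1 - \<beta>) * Y) + \<beta> * Y"
          using nc by linarith
        also have "\<dots> = P - \<beta> * c" by (simp add: P_def algebra_simps power2_eq_square)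
        also have "\<dots> \<le> P" using \<beta> c by simp
        finally show ?thesis .
      next
        case False
        then have "x k \<le> P" "x (Suc k) \<le> P" using step.IH by auto
        then have "(1 - \<beta>) * x (Suc k) \<le> (1 - \<beta>) * P" "\<beta> * x k \<le> \<beta> * P"
          using \<beta> by (auto intro!: mult_left_mono)
        then have "x (Suc (Suc k)) \<le> (1 - \<beta>) * P + \<beta> * P" using nc by linarith
        then show ?thesis by (simp add: algebra_simps)
      qed
      then show ?thesis using step.IH by simp
    qed
  qed
  then have "\<forall>k\<ge>Suc m. x k \<le> P" by (metis Suc_le_D Suc_le_mono)
  then show ?thesis unfolding P_def eventually_sequentially by blast
qed

text \<open>The improvement map contracts with factor \<open>L = 1 - \<beta> * (1 - \<beta>)\<close>
  towards its fixed point \<open>Z\<close>. Iterating it shrinks the excess over \<open>Z\<close>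
  geometrically; the slack 1 is reached after finitely many rounds.\<close>

lemma crossing_recursion_eventually_le:
  fixes x :: "nat \<Rightarrow> real" and C :: "nat \<Rightarrow> bool"
  assumes \<beta>: "0 < \<beta>" "\<beta> < 1" and c: "0 \<le> c"
    and cross: "\<And>k. C k \<Longrightarrow> x (Suc k) \<le> c + (1 - \<beta>) * x k"
    and no_cross: "\<And>k. \<not> C (Suc k) \<Longrightarrow> x (Suc (Suc k)) \<le> (1 - \<beta>) * x (Suc k) + \<beta> * x k"
    and inf: "\<exists>\<^sub>\<infinity>k. C k"
  shows "\<forall>\<^sub>F k in sequentially. x k \<le> c / (\<beta> * (1 - \<beta>)) + 1"
proof -
  define L where "L = 1 - \<beta> + \<beta>\<^sup>2"
  define Z where "Z = c / (\<beta> * (1 - \<beta>))"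
  have Z0: "Z \<ge> 0" using \<beta> c by (simp add: Z_def)
  have fix_Z: "L * Z + c = Z"
  proof -
    have "\<beta> * (1 - \<beta>) * Z = c" using \<beta> by (simp add: Z_def)
    then show ?thesis by (simp add: L_def algebra_simps power2_eq_square)
  qed
  have "0 \<le> L" using \<beta> by (simp add: L_def)
  moreover have "L < 1"
  proof -
    have "\<beta> * (1 - \<beta>) > 0" using \<beta> by simp
    then show ?thesis by (simp add: L_def algebra_simps power2_eq_square)
  qed
  ultimately have L: "0 \<le> L" "L < 1" .
  obtain M where M: "\<And>k. x k \<le> M"
    using crossing_recursion_bounded[where x = x, OF \<beta> cross no_cross] by blast
  \<comment> \<open>Truncation at 0 keeps every bound \<open>Z + L ^ n * D\<close> nonnegative, as
    the contraction requires.\<close>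
  define D where "D = max 0 (M - Z)"
  have ev: "\<forall>\<^sub>F k in sequentially. x k \<le> Z + L ^ n * D" for n
  proof (induction n)
    case 0
    have "x k \<le> Z + D" for k using M[of k] by (simp add: D_def)
    then show ?case by simp
  next
    case (Suc n)
    have "0 \<le> Z + L ^ n * D" using Z0 L by (simp add: D_def)
    from crossing_recursion_contract[where x = x, OF \<beta> c this cross no_cross inf Suc]
    have "\<forall>\<^sub>F k in sequentially. x k \<le> L * (Z + L ^ n * D) + c" by (simp add: L_def)
    also have "L * (Z + L ^ n * D) + c = Z + L ^ Suc n * D"
      using fix_Z by (simp add: algebra_simps)
    finally show ?case .
  qed
  have "(\<lambda>n. L ^ n * D) \<longlonglongrightarrow> 0"
    using L by (intro tendsto_mult_left_zero LIMSEQ_realpow_zero)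
  then have "\<forall>\<^sub>F n in sequentially. L ^ n * D < 1"
    by (rule order_tendstoD) simp
  then obtain n where "L ^ n * D < 1"
    by (auto simp: eventually_sequentially)
  with ev[of n] show ?thesis
    unfolding Z_def by (auto elim!: eventually_mono)
qed

section \<open>The recursion with the minimizer moved to the origin\<close>

locale gradient_recursion =
  fixes g :: "real \<Rightarrow> real" and \<mu> \<beta> \<rho> :: real and u :: "nat \<Rightarrow> real"
  assumes \<beta>: "0 < \<beta>" "\<beta> < 1" and \<mu>: "0 < \<mu>" and \<rho>: "0 < \<rho>"
    and mono_g: "mono g"
    and g_zero_iff: "g x = 0 \<longleftrightarrow> x = 0"
    and g_bound: "\<bar>g x\<bar> \<le> \<mu> * \<bar>x\<bar>"
    and distinct: "u (Suc k) \<noteq> u k"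
    and rec: "u (Suc (Suc k)) = u (Suc k) - \<rho> * g (u (Suc k)) * \<bar>u (Suc k) - u k\<bar> powr (- \<beta>)"
begin

definition d :: "nat \<Rightarrow> real" where "d k = \<bar>u (Suc k) - u k\<bar>"

definition crossing :: "nat \<Rightarrow> bool" where "crossing k \<longleftrightarrow> u k * u (Suc k) < 0"

lemma d_pos: "d k > 0"
  using distinct by (simp add: d_def)

lemma d_Suc: "d (Suc k) = \<rho> * \<bar>g (u (Suc k))\<bar> * d k powr (- \<beta>)"
  using \<rho> by (simp add: d_def rec[of k] abs_mult)

text \<open>At the minimizer the gradient vanishes, so the next step would have length zero. Only
  the initial \<open>u 0\<close> escapes this argument.\<close>

lemma u_Suc_nonzero: "u (Suc k) \<noteq> 0"
  using d_pos[of "Suc k"] d_Suc[of k] g_zero_iff[of 0] by auto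

lemma g_pos: "x > 0 \<Longrightarrow> g x > 0"
  using monoD[OF mono_g, of 0 x] g_zero_iff[of 0] g_zero_iff[of x] by simp

lemma g_neg: "x < 0 \<Longrightarrow> g x < 0"
  using monoD[OF mono_g, of x 0] g_zero_iff[of 0] g_zero_iff[of x] by simp

lemma crossing_abs_le: "crossing k \<Longrightarrow> \<bar>u (Suc k)\<bar> \<le> d k"
  by (auto simp: crossing_def d_def mult_less_0_iff)

text \<open>The sign of \<open>g\<close> makes every computed step point towards 0. The index starts
  at \<open>Suc k\<close> because the step from \<open>u 0\<close> to \<open>u 1\<close> is
  arbitrary.\<close>

lemma no_crossing_same_side:
  assumes "\<not> crossing (Suc k)"
  shows "0 < u (Suc (Suc k)) \<and> u (Suc (Suc k)) \<le> u (Suc k) \<or>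
         u (Suc k) \<le> u (Suc (Suc k)) \<and> u (Suc (Suc k)) < 0"
proof (cases "u (Suc k) > 0")
  case True
  have "\<rho> * g (u (Suc k)) * \<bar>u (Suc k) - u k\<bar> powr (- \<beta>) \<ge> 0"
    using \<rho> g_pos[OF True] by simp
  then show ?thesis
    using assms True u_Suc_nonzero[of "Suc k"] rec[of k]
    by (auto simp: crossing_def mult_less_0_iff)
next
  case False
  then have neg: "u (Suc k) < 0" using u_Suc_nonzero[of k] by simp
  have "\<rho> * g (u (Suc k)) * \<bar>u (Suc k) - u k\<bar> powr (- \<beta>) \<le> 0"
    using \<rho> g_neg[OF neg] by (simp add: mult_nonneg_nonpos mult_nonpos_nonneg)
  then show ?thesis
    using assms neg u_Suc_nonzero[of "Suc k"] rec[of k]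
    by (auto simp: crossing_def mult_less_0_iff)
qed

lemma no_crossing_abs_le:
  assumes "\<not> crossing (Suc k)"
  shows "\<bar>u (Suc (Suc k))\<bar> \<le> \<bar>u (Suc k)\<bar>"
  using no_crossing_same_side[OF assms] by auto

lemma no_crossing_g_le:
  assumes "\<not> crossing (Suc k)"
  shows "\<bar>g (u (Suc (Suc k)))\<bar> \<le> \<bar>g (u (Suc k))\<bar>"
  using no_crossing_same_side[OF assms]
proof
  assume *: "0 < u (Suc (Suc k)) \<and> u (Suc (Suc k)) \<le> u (Suc k)"
  then show ?thesis
    using g_pos[of "u (Suc (Suc k))"] monoD[OF mono_g, of "u (Suc (Suc k))" "u (Suc k)"] by simp
next
  assume *: "u (Suc k) \<le> u (Suc (Suc k)) \<and> u (Suc (Suc k)) < 0"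
  then show ?thesis
    using g_neg[of "u (Suc (Suc k))"] monoD[OF mono_g, of "u (Suc k)" "u (Suc (Suc k))"] by simp
qed

text \<open>The overshoot is part of the step, so the gradient is at most
  \<open>\<mu> * d k\<close>, and \<open>d k * d k powr (- \<beta>)\<close> has exponent
  \<open>1 - \<beta>\<close>.\<close>

lemma ln_d_crossing:
  assumes "crossing k"
  shows "ln (d (Suc k)) \<le> ln (\<rho> * \<mu>) + (1 - \<beta>) * ln (d k)"
proof -
  have "\<bar>g (u (Suc k))\<bar> \<le> \<mu> * d k"
    using g_bound[of "u (Suc k)"] crossing_abs_le[OF assms] \<mu>
    by (meson mult_left_mono less_imp_le order_trans)
  then have "d (Suc k) \<le> \<rho> * (\<mu> * d k) * d k powr (- \<beta>)"
    unfolding d_Suc using \<rho> by (intro mult_right_mono mult_left_mono) auto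
  then have "ln (d (Suc k)) \<le> ln (\<rho> * (\<mu> * d k) * d k powr (- \<beta>))"
    using d_pos[of "Suc k"] by (rule ln_mono)
  also have "\<dots> = ln (\<rho> * \<mu>) + (1 - \<beta>) * ln (d k)"
    using \<rho> \<mu> d_pos[of k] by (simp add: ln_mult ln_powr algebra_simps)
  finally show ?thesis .
qed

lemma ln_d_Suc: "ln (d (Suc k)) = ln (\<rho> * \<bar>g (u (Suc k))\<bar>) - \<beta> * ln (d k)"
proof -
  have "g (u (Suc k)) \<noteq> 0" using g_zero_iff u_Suc_nonzero by simp
  then show ?thesis
    unfolding d_Suc using \<rho> d_pos[of k] by (simp add: ln_mult ln_powr)
qed

text \<open>Subtracting two consecutive instances of \<open>ln_d_Suc\<close> leaves a difference of
  gradient logarithms, which is nonpositive here.\<close>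

lemma ln_d_no_crossing:
  assumes "\<not> crossing (Suc k)"
  shows "ln (d (Suc (Suc k))) \<le> (1 - \<beta>) * ln (d (Suc k)) + \<beta> * ln (d k)"
proof -
  have nz: "g (u (Suc (Suc k))) \<noteq> 0" using g_zero_iff u_Suc_nonzero by simp
  have "ln (\<rho> * \<bar>g (u (Suc (Suc k)))\<bar>) \<le> ln (\<rho> * \<bar>g (u (Suc k))\<bar>)"
    using no_crossing_g_le[OF assms] \<rho> nz by (intro ln_mono) auto
  then show ?thesis
    using ln_d_Suc[of k] ln_d_Suc[of "Suc k"] by (simp add: algebra_simps)
qed

lemma finitely_many_crossings_tendsto:
  assumes "\<not> (\<exists>\<^sub>\<infinity>k. crossing k)"
  shows "u \<longlonglongrightarrow> 0"
proof -
  obtain N where N: "\<And>k. k \<ge> N \<Longrightarrow> \<not> crossing k"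
    using assms by (auto simp: INFM_nat_le)
  define v where "v j = \<bar>u (Suc (N + j))\<bar>" for j
  have dec: "decseq v"
    using no_crossing_abs_le N by (auto simp: decseq_Suc_iff v_def)
  obtain a where a: "v \<longlonglongrightarrow> a" "\<And>j. a \<le> v j"
    by (rule decseq_convergent[OF dec, of 0]) (auto simp: v_def)
  \<comment> \<open>On one side of 0, each step length is exactly the loss of distance.\<close>
  have d_v: "d (Suc (N + j)) = v j - v (Suc j)" for j
    using no_crossing_same_side[OF N, of "N + j"] by (auto simp: d_def v_def)
  have "(\<lambda>j. v j - v (Suc j)) \<longlonglongrightarrow> a - a"
    by (intro tendsto_diff a(1) LIMSEQ_Suc)
  then have d0: "(\<lambda>j. d (Suc (N + j))) \<longlonglongrightarrow> 0" by (simp add: d_v)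
  \<comment> \<open>Multiplying the recursion by \<open>d powr \<beta>\<close> removes the negative
    power, which would blow up as the steps vanish, and isolates the gradient.\<close>
  then have "(\<lambda>j. d (Suc (N + j)) powr \<beta>) \<longlonglongrightarrow> 0 powr \<beta>"
    using d_pos \<beta> by (intro tendsto_powr') (auto simp: less_imp_le)
  then have "(\<lambda>j. d (Suc (N + Suc j)) * d (Suc (N + j)) powr \<beta>) \<longlonglongrightarrow> 0"
    using tendsto_mult[OF LIMSEQ_Suc[OF d0]] by fastforce
  moreover have "d (Suc (N + Suc j)) * d (Suc (N + j)) powr \<beta> = \<rho> * \<bar>g (u (Suc (N + Suc j)))\<bar>" for j
    using d_Suc[of "Suc (N + j)"] d_pos[of "Suc (N + j)"] by (simp add: powr_minus)
  ultimately have g0: "(\<lambda>j. \<rho> * \<bar>g (u (Suc (N + Suc j)))\<bar>) \<longlonglongrightarrow> 0" by simp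
  have "a = 0"
  proof (rule ccontr)
    assume "a \<noteq> 0"
    moreover have "a \<ge> 0" using a(1) by (rule LIMSEQ_le_const) (auto simp: v_def)
    ultimately have "a > 0" by simp
    \<comment> \<open>By monotonicity, \<open>e\<close> bounds the gradient from below on both sides
      outside the interval from \<open>- a\<close> to \<open>a\<close>, where all these iterates
      lie.\<close>
    define e where "e = min (g a) (- g (- a))"
    have "e > 0" using g_pos[of a] g_neg[of "- a"] \<open>a > 0\<close> by (simp add: e_def)
    have "e \<le> \<bar>g (u (Suc (N + Suc j)))\<bar>" for j
    proof -
      have "a \<le> u (Suc (N + Suc j)) \<or> u (Suc (N + Suc j)) \<le> - a"
        using a(2)[of "Suc j"] by (auto simp: v_def abs_if split: if_splits)
      then show ?thesis
        using monoD[OF mono_g, of a "u (Suc (N + Suc j))"]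
          monoD[OF mono_g, of "u (Suc (N + Suc j))" "- a"] by (auto simp: e_def)
    qed
    then have "\<rho> * e \<le> \<rho> * \<bar>g (u (Suc (N + Suc j)))\<bar>" for j
      using \<rho> by (intro mult_left_mono) auto
    then have "\<rho> * e \<le> 0" by (intro LIMSEQ_le_const[OF g0]) blast
    then show False using \<rho> \<open>e > 0\<close> by (simp add: mult_le_0_iff)
  qed
  then have "(\<lambda>j. u (j + Suc N)) \<longlonglongrightarrow> 0"
    using a(1) tendsto_rabs_zero_iff[of "\<lambda>j. u (Suc (N + j))"]
    by (simp add: v_def[abs_def] add.commute)
  then show ?thesis by (rule LIMSEQ_offset)
qed

lemma eventually_abs_le:
  "\<forall>\<^sub>F k in sequentially. \<bar>u k\<bar> \<le> exp (\<bar>ln (\<rho> * \<mu>)\<bar> / (\<beta> * (1 - \<beta>)) + 1)"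
    (is "\<forall>\<^sub>F k in _. _ \<le> ?B")
proof (cases "\<exists>\<^sub>\<infinity>k. crossing k")
  case False
  have "(\<lambda>k. \<bar>u k\<bar>) \<longlonglongrightarrow> 0"
    using finitely_many_crossings_tendsto[OF False] by (rule tendsto_rabs_zero)
  then have "\<forall>\<^sub>F k in sequentially. \<bar>u k\<bar> < ?B"
    by (rule order_tendstoD) simp
  then show ?thesis by (rule eventually_mono) simp
next
  case True
  \<comment> \<open>The absolute value makes the constant nonnegative even when
    \<open>\<rho> * \<mu> < 1\<close>.\<close>
  have "ln (d (Suc k)) \<le> \<bar>ln (\<rho> * \<mu>)\<bar> + (1 - \<beta>) * ln (d k)" if "crossing k" for k
    using ln_d_crossing[OF that] by linarith
  from crossing_recursion_eventually_le
    [where x = "\<lambda>k. ln (d k)", OF \<beta> abs_ge_zero this ln_d_no_crossing True]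
  have "\<forall>\<^sub>F k in sequentially. ln (d k) \<le> \<bar>ln (\<rho> * \<mu>)\<bar> / (\<beta> * (1 - \<beta>)) + 1"
    .
  then have "\<forall>\<^sub>F k in sequentially. d k \<le> ?B"
  proof (rule eventually_mono)
    fix k
    assume "ln (d k) \<le> \<bar>ln (\<rho> * \<mu>)\<bar> / (\<beta> * (1 - \<beta>)) + 1"
    then have "exp (ln (d k)) \<le> ?B" by (rule exp_mono)
    then show "d k \<le> ?B" using d_pos by simp
  qed
  then obtain N where N: "\<And>k. k \<ge> N \<Longrightarrow> d k \<le> ?B"
    by (auto simp: eventually_sequentially)
  obtain m where m: "m \<ge> N" "crossing m"
    using True by (auto simp: INFM_nat_le)
  \<comment> \<open>The step bound passes to the distances: a crossing bounds the new distance by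
    the step, and other steps do not increase it. The induction starts at a crossing.\<close>
  have "\<bar>u (Suc k)\<bar> \<le> ?B" if "k \<ge> m" for k
    using that
  proof (induction k rule: dec_induct)
    case base
    then show ?case using crossing_abs_le[OF m(2)] N[OF m(1)] by linarith
  next
    case (step k)
    show ?case
    proof (cases "crossing (Suc k)")
      case True
      then show ?thesis using crossing_abs_le[OF True] N[of "Suc k"] step m(1) by linarith
    next
      case False
      then show ?thesis using no_crossing_abs_le[OF False] step.IH by linarith
    qed
  qed
  then have "\<forall>k\<ge>Suc m. \<bar>u k\<bar> \<le> ?B" by (metis Suc_le_D Suc_le_mono)
  then show ?thesis unfolding eventually_sequentially by blast
qed

end

section \<open>Derivatives of convex functions, and the return to the method\<close>

text \<open>Adding the tangent inequalities at the two points cancels the values of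
  \<open>f\<close>.\<close>

lemma convex_on_deriv_mono:
  fixes f :: "real \<Rightarrow> real"
  assumes "convex_on UNIV f" and "\<And>x. f differentiable at x"
  shows "mono (deriv f)"
proof (rule monoI)
  fix x y :: real
  assume "x \<le> y"
  have tangent: "f b - f a \<ge> deriv f a * (b - a)" for a b
    using assms
    by (intro convex_on_imp_above_tangent[where A = UNIV])
      (auto simp: DERIV_deriv_iff_real_differentiable)
  have "(deriv f y - deriv f x) * (y - x) \<ge> 0"
    using tangent[of x y] tangent[of y x] by (simp add: algebra_simps)
  with \<open>x \<le> y\<close> show "deriv f x \<le> deriv f y"
    by (cases "x = y") (auto simp: zero_le_mult_iff)
qed

text \<open>A horizontal tangent lies below the whole graph; the converse is Fermat's rule.\<close>

lemma convex_on_deriv_zero_iff: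
  fixes f :: "real \<Rightarrow> real"
  assumes "convex_on UNIV f" and "\<And>x. f differentiable at x"
  shows "deriv f x = 0 \<longleftrightarrow> (\<forall>y. f x \<le> f y)"
proof
  assume "deriv f x = 0"
  moreover have "f y - f x \<ge> deriv f x * (y - x)" for y
    using assms
    by (intro convex_on_imp_above_tangent[where A = UNIV])
      (auto simp: DERIV_deriv_iff_real_differentiable)
  ultimately show "\<forall>y. f x \<le> f y" by simp
next
  assume "\<forall>y. f x \<le> f y"
  moreover have "(f has_real_derivative deriv f x) (at x)"
    using assms(2) by (simp add: DERIV_deriv_iff_real_differentiable)
  ultimately show "deriv f x = 0"
    by (intro DERIV_local_min[of f _ x 1]) auto
qed

theorem theorem1:
  fixes f :: "real \<Rightarrow> real" and tstar \<mu> \<alpha> \<rho> :: real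
  assumes smooth: "f C1_differentiable_on UNIV"
    and convex: "convex_on UNIV f"
    and unique_minimizer: "\<forall>x. (\<forall>y. f x \<le> f y) \<longleftrightarrow> x = tstar"
    and mu_pos: "\<mu> > 0"
    and lipschitz_gradient: "\<forall>x y. \<bar>deriv f x - deriv f y\<bar> \<le> \<mu> * \<bar>x - y\<bar>"
    and alpha: "1 < \<alpha>" "\<alpha> < 2"
    and rho_pos: "\<rho> > 0"
  shows "\<exists>B\<ge>0. \<forall>t. fractional_gradient_seq f \<alpha> \<rho> t \<longrightarrow>
           limsup (\<lambda>k. ereal \<bar>t k - tstar\<bar>) \<le> ereal B"
proof -
  \<comment> \<open>This is the bound for the shifted recursion with
    \<open>\<beta> = \<alpha> - 1\<close>; it is fixed before any sequence is chosen.\<close>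
  define B where "B = exp (\<bar>ln (\<rho> * \<mu>)\<bar> / ((\<alpha> - 1) * (1 - (\<alpha> - 1))) + 1)"
  define g where "g x = deriv f (x + tstar)" for x
  have diff: "f differentiable at x" for x
    using smooth by (simp add: C1_differentiable_on_eq)
  have zero_iff: "deriv f x = 0 \<longleftrightarrow> x = tstar" for x
    using convex_on_deriv_zero_iff[OF convex diff] unique_minimizer by blast
  have "limsup (\<lambda>k. ereal \<bar>t k - tstar\<bar>) \<le> ereal B"
    if t: "fractional_gradient_seq f \<alpha> \<rho> t" for t
  proof -
    \<comment> \<open>The index shift makes \<open>u 0\<close> correspond to \<open>t 1\<close>, so
      \<open>t 0\<close> never enters.\<close>
    define u where "u k = t (Suc k) - tstar" for k
    interpret gradient_recursion g \<mu> "\<alpha> - 1" \<rho> u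
    proof
      show "mono g"
        using convex_on_deriv_mono[OF convex diff] by (auto simp: g_def mono_def)
      show "g x = 0 \<longleftrightarrow> x = 0" for x
        by (simp add: g_def zero_iff)
      show "\<bar>g x\<bar> \<le> \<mu> * \<bar>x\<bar>" for x
        using lipschitz_gradient[rule_format, of "x + tstar" tstar] zero_iff[of tstar]
        by (simp add: g_def)
      show "u (Suc k) \<noteq> u k" for k
        using t by (simp add: fractional_gradient_seq_def u_def)
      show "u (Suc (Suc k)) =
          u (Suc k) - \<rho> * g (u (Suc k)) * \<bar>u (Suc k) - u k\<bar> powr (- (\<alpha> - 1))" for k
        using t[unfolded fractional_gradient_seq_def, THEN conjunct2, rule_format, of "Suc k"]
        by (simp add: u_def g_def)
    qed (use alpha mu_pos rho_pos in auto)
    have "\<forall>\<^sub>F k in sequentially. \<bar>t (Suc k) - tstar\<bar> \<le> B"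
      using eventually_abs_le by (simp add: B_def u_def)
    then have "\<forall>\<^sub>F k in sequentially. \<bar>t k - tstar\<bar> \<le> B"
      by (rule eventually_sequentially_Suc[THEN iffD1])
    then show ?thesis
      by (intro Limsup_bounded) simp
  qed
  moreover have "B \<ge> 0" by (simp add: B_def)
  ultimately show ?thesis by blast
qed

end
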